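(* Let $\Gamma$ be a spine of an orbifold Riemann surface $\Sigma_{g,s,r}$, let $Z$ be (the variable of) a pending edge of $\Gamma$ ending at an orbifold point of order $p\ge 2$, put $\varphi=\pi/p$, $w=2\cos(\pi/p)=e^{i\varphi}+e^{-i\varphi}$, and let $A,B$ be the other two (distinct) edges at the three-valent vertex of $Z$, so that the clockwise cyclic order at this vertex is $(Z,A,B)$; either or both of $A,B$ may themselves be pending edges. Let $\Gamma'$ be the spine obtained by flipping $Z$, i.e. the graph $\Gamma$ in which the clockwise cyclic order at this vertex is replaced by $(A,Z,B)$. Then the transformation $$\tilde A=A+\phi^\hbar(Z+i\varphi)+\phi^\hbar(Z-i\varphi),\qquad \tilde B=B-\phi^\hbar(-Z+i\varphi)-\phi^\hbar(-Z-i\varphi),\qquad \tilde Z=-Z,$$ with all other edge variables unchanged, is a morphism of the quantum $*$-algebras: the transformed elements are self-adjoint and satisfy exactly the commutation relations of the quantum algebra $\mathfrak T^\hbar(\Gamma')$ (with $\tilde A,\tilde B,\tilde Z$ in the roles of the generators of the edges $A,B,Z$ of $\Gamma'$).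
   Context: A spine $\Gamma$ of $\Sigma_{g,s,r}$ (genus $g$, $s>0$ holes, $r$ orbifold points) is a fat graph (a graph with a cyclic ordering of the edges at each vertex) embedded in $\Sigma_{g,s,r}$, all of whose vertices are three-valent except for exactly $r$ one-valent vertices placed at the orbifold points (the edges ending there are called pending edges), and such that cutting along its edges splits the surface into $s$ polygons, each containing exactly one hole and simply connected once the hole is contracted. To each edge $\alpha$ one associates a variable $Z_\alpha$. Poisson bracket: $\{f,g\}=\sum_{\text{3-valent vertices}}\sum_{i=1}^{3}\left(\frac{\partial f}{\partial Z_{\alpha_i}}\frac{\partial g}{\partial Z_{\alpha_{i+1}}}-\frac{\partial g}{\partial Z_{\alpha_i}}\frac{\partial f}{\partial Z_{\alpha_{i+1}}}\right)$, where $\alpha_1,\alpha_2,\alpha_3$ (indices mod 3) are the edges at the vertex in clockwise order. Thus a vertex with clockwise order $(\alpha_1,\alpha_2,\alpha_3)$ contributes $+1$ to each of $\{Z_{\alpha_1},Z_{\alpha_2}\}$, $\{Z_{\alpha_2},Z_{\alpha_3}\}$, $\{Z_{\alpha_3},Z_{\alpha_1}\}$. Quantum algebra $\mathfrak T^\hbar(\Gamma)$, $\hbar>0$: the $*$-algebra generated by self-adjoint $Z_\alpha$ (one per edge) with scalar commutators $[Z_\alpha,Z_\beta]=2\pi i\hbar\{Z_\alpha,Z_\beta\}$. Functions of a single generator are allowed in the usual way; if $[W,Z]$ is a scalar then $[W,f(Z)]=[W,Z]f'(Z)$. Quantum dilogarithm: $\phi^\hbar(z)=-\frac{\pi\hbar}{2}\int_{\Omega}\frac{e^{-i\xi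 z}}{\sinh(\pi \xi)\sinh(\pi\hbar \xi)}\,d\xi$, where $\Omega$ runs along the real axis bypassing the origin from above. It satisfies $\phi^\hbar(z)-\phi^\hbar(-z)=z$, $\overline{\phi^\hbar(z)}=\phi^\hbar(\bar z)$, and $\phi^\hbar(z+i\pi\hbar)-\phi^\hbar(z-i\pi\hbar)=\frac{2\pi i\hbar}{e^{-z}+1}$. *)

theory Defs
  imports "HOL-Complex_Analysis.Complex_Analysis" "HOL-Combinatorics.Orbits"
begin

section \<open>Fat graphs and spines\<close>

text \<open>
  A fat graph is given by its half-edges. \<^term>\<open>rot\<close> sends a half-edge to the next one in clockwise
  order at the same vertex, \<^term>\<open>opp\<close> exchanges the two halves of an edge, and \<^term>\<open>orb_order\<close>
  records the order of the orbifold point at which the vertex of a half-edge is placed (it is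
  relevant only for half-edges at one-valent vertices).
\<close>

record 'h fatgraph =
  darts :: "'h set"
  rot :: "'h \<Rightarrow> 'h"
  opp :: "'h \<Rightarrow> 'h"
  orb_order :: "'h \<Rightarrow> nat"

definition edge_at :: "('h, 'x) fatgraph_scheme \<Rightarrow> 'h \<Rightarrow> 'h set" where
  "edge_at G h = {h, opp G h}"

definition vertex_at :: "('h, 'x) fatgraph_scheme \<Rightarrow> 'h \<Rightarrow> 'h set" where
  "vertex_at G h = orbit (rot G) h"

definition edges :: "('h, 'x) fatgraph_scheme \<Rightarrow> 'h set set" where
  "edges G = edge_at G ` darts G"

definition vertices :: "('h, 'x) fatgraph_scheme \<Rightarrow> 'h set set" where
  "vertices G = vertex_at G ` darts G"

definition boundary_cycles :: "('h, 'x) fatgraph_scheme \<Rightarrow> 'h set set" where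
  "boundary_cycles G = orbit (rot G \<circ> opp G) ` darts G"

definition fat_graph :: "('h, 'x) fatgraph_scheme \<Rightarrow> bool" where
  "fat_graph G \<longleftrightarrow> finite (darts G) \<and> rot G permutes darts G \<and> opp G permutes darts G \<and>
     (\<forall>h\<in>darts G. opp G h \<noteq> h \<and> opp G (opp G h) = h)"

definition fat_graph_connected :: "('h, 'x) fatgraph_scheme \<Rightarrow> bool" where
  "fat_graph_connected G \<longleftrightarrow>
     (\<forall>h\<in>darts G. \<forall>k\<in>darts G. (h, k) \<in> {(x, y). y = rot G x \<or> y = opp G x}\<^sup>*)"

text \<open>
  A fat graph determines, up to homeomorphism, the oriented surface in which it is embedded with
  complement a union of once-holed polygons: the polygons are the boundary cycles, and contracting
  every hole to a point yields a cell decomposition of the closed surface of genus \<open>g\<close>, whose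
  Euler characteristic is \<open>2 - 2 * g\<close>. In this sense the following says that \<open>G\<close> is a spine of the
  surface of genus \<open>g\<close> with \<open>s\<close> holes and \<open>r\<close> orbifold points.
\<close>

definition spine :: "nat \<Rightarrow> nat \<Rightarrow> nat \<Rightarrow> ('h, 'x) fatgraph_scheme \<Rightarrow> bool" where
  "spine g s r G \<longleftrightarrow>
     fat_graph G \<and> fat_graph_connected G \<and>
     (\<forall>v\<in>vertices G. card v = 3 \<or> card v = 1) \<and>
     card {v \<in> vertices G. card v = 1} = r \<and>
     (\<forall>h\<in>darts G. card (vertex_at G h) = 1 \<longrightarrow> 2 \<le> orb_order G h) \<and>
     0 < s \<and> card (boundary_cycles G) = s \<and>
     int (card (vertices G)) - int (card (edges G)) + int (card (boundary_cycles G)) = 2 - 2 * int g"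

text \<open>
  Reversal of the cyclic order at the three-valent vertex of the half-edge \<open>z\<close>: the clockwise order
  \<open>(z, a, b)\<close> becomes \<open>(a, z, b)\<close>.
\<close>

definition flip :: "'h \<Rightarrow> ('h, 'x) fatgraph_scheme \<Rightarrow> ('h, 'x) fatgraph_scheme" where
  "flip z G = (let a = rot G z; b = rot G a in G\<lparr>rot := (rot G)(a := z, z := b, b := a)\<rparr>)"


section \<open>The Poisson bracket\<close>

definition partial_deriv :: "'e \<Rightarrow> (('e \<Rightarrow> real) \<Rightarrow> real) \<Rightarrow> ('e \<Rightarrow> real) \<Rightarrow> real" where
  "partial_deriv e f x = deriv (\<lambda>t. f (x(e := t))) (x e)"

text \<open>The inner sum runs over the three consecutive pairs of half-edges at the vertex.\<close>

definition poisson :: "('h, 'x) fatgraph_scheme \<Rightarrow>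
    (('h set \<Rightarrow> real) \<Rightarrow> real) \<Rightarrow> (('h set \<Rightarrow> real) \<Rightarrow> real) \<Rightarrow> ('h set \<Rightarrow> real) \<Rightarrow> real" where
  "poisson G f g x =
     (\<Sum>v\<in>{v \<in> vertices G. card v = 3}. \<Sum>h\<in>v.
        partial_deriv (edge_at G h) f x * partial_deriv (edge_at G (rot G h)) g x
      - partial_deriv (edge_at G h) g x * partial_deriv (edge_at G (rot G h)) f x)"

text \<open>
  The bracket of two coordinate functions is a constant function; the point of evaluation is
  immaterial.
\<close>

definition edge_bracket :: "('h, 'x) fatgraph_scheme \<Rightarrow> 'h set \<Rightarrow> 'h set \<Rightarrow> real" where
  "edge_bracket G \<alpha> \<beta> = poisson G (\<lambda>x. x \<alpha>) (\<lambda>x. x \<beta>) (\<lambda>_. 0)"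


section \<open>The quantum algebra\<close>

locale complex_star_algebra = vector_space cscale
  for cscale :: "complex \<Rightarrow> 'a::ring_1 \<Rightarrow> 'a" +
  fixes star :: "'a \<Rightarrow> 'a"
  assumes cscale_mult_left: "cscale c (x * y) = cscale c x * y"
    and cscale_mult_right: "cscale c (x * y) = x * cscale c y"
    and star_add: "star (x + y) = star x + star y"
    and star_cscale: "star (cscale c x) = cscale (cnj c) (star x)"
    and star_mult: "star (x * y) = star y * star x"
    and star_star: "star (star x) = x"

definition quantum_relations :: "(complex \<Rightarrow> 'a::ring_1 \<Rightarrow> 'a) \<Rightarrow> ('a \<Rightarrow> 'a) \<Rightarrow>
    ('h, 'x) fatgraph_scheme \<Rightarrow> real \<Rightarrow> ('h set \<Rightarrow> 'a) \<Rightarrow> bool" where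
  "quantum_relations cscale star G hbar Z \<longleftrightarrow>
     (\<forall>\<alpha>\<in>edges G. star (Z \<alpha>) = Z \<alpha>) \<and>
     (\<forall>\<alpha>\<in>edges G. \<forall>\<beta>\<in>edges G.
        Z \<alpha> * Z \<beta> - Z \<beta> * Z \<alpha> = cscale (2 * pi * \<i> * hbar * edge_bracket G \<alpha> \<beta>) 1)"

text \<open>
  The functions to which a generator may be substituted: smooth functions on the real line all of
  whose derivatives grow at most polynomially. With this class the functional calculus below is
  realised by operators on Schwartz space, which would be problematic without a growth condition.
\<close>

definition tempered_smooth :: "(real \<Rightarrow> complex) \<Rightarrow> bool" where
  "tempered_smooth f \<longleftrightarrow> (\<exists>D. D 0 = f \<and>
     (\<forall>k x. (D k has_vector_derivative D (Suc k) x) (at x)) \<and>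
     (\<forall>k. \<exists>C n. \<forall>x. norm (D k x) \<le> C * (1 + \<bar>x\<bar>) ^ n))"

text \<open>
  A \<open>*\<close>-algebra containing the generators \<open>Z \<alpha>\<close> and the functions \<open>fc \<alpha> f\<close>, that is \<open>f (Z \<alpha>)\<close>, of
  single generators. The algebra generated by them is not singled out: what is shown for
  every such algebra holds in particular for that one.
\<close>

locale quantum_algebra = complex_star_algebra cscale star
  for cscale :: "complex \<Rightarrow> 'a::ring_1 \<Rightarrow> 'a" and star :: "'a \<Rightarrow> 'a" +
  fixes G :: "'h fatgraph" and hbar :: real and Z :: "'h set \<Rightarrow> 'a"
    and fc :: "'h set \<Rightarrow> (real \<Rightarrow> complex) \<Rightarrow> 'a"
  assumes hbar_pos: "0 < hbar"
    and relations: "quantum_relations cscale star G hbar Z"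
    and fc_const: "\<alpha> \<in> edges G \<Longrightarrow> fc \<alpha> (\<lambda>_. c) = cscale c 1"
    and fc_id: "\<alpha> \<in> edges G \<Longrightarrow> fc \<alpha> (\<lambda>x. of_real x) = Z \<alpha>"
    and fc_add: "\<lbrakk>\<alpha> \<in> edges G; tempered_smooth f; tempered_smooth g\<rbrakk> \<Longrightarrow>
      fc \<alpha> (\<lambda>x. f x + g x) = fc \<alpha> f + fc \<alpha> g"
    and fc_mult: "\<lbrakk>\<alpha> \<in> edges G; tempered_smooth f; tempered_smooth g\<rbrakk> \<Longrightarrow>
      fc \<alpha> (\<lambda>x. f x * g x) = fc \<alpha> f * fc \<alpha> g"
    and fc_star: "\<lbrakk>\<alpha> \<in> edges G; tempered_smooth f\<rbrakk> \<Longrightarrow>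
      fc \<alpha> (\<lambda>x. cnj (f x)) = star (fc \<alpha> f)"
    and fc_commutator:
      "\<lbrakk>\<alpha> \<in> edges G; tempered_smooth f; \<And>x. (f has_vector_derivative f' x) (at x);
        W * Z \<alpha> - Z \<alpha> * W = cscale c 1\<rbrakk> \<Longrightarrow>
      W * fc \<alpha> f - fc \<alpha> f * W = cscale c (fc \<alpha> f')"


section \<open>The quantum dilogarithm\<close>

text \<open>
  Integration along the real axis, bypassing the origin from above on a half-circle of
  radius \<open>\<epsilon>\<close>.
\<close>

definition Omega_integral :: "real \<Rightarrow> (complex \<Rightarrow> complex) \<Rightarrow> complex" where
  "Omega_integral \<epsilon> F =
     (LBINT x:{..-\<epsilon>}. F (of_real x)) + contour_integral (part_circlepath 0 \<epsilon> pi 0) F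
     + (LBINT x:{\<epsilon>..}. F (of_real x))"

text \<open>
  The poles of the integrand are the points \<open>\<i> * k\<close> and \<open>\<i> * k / hbar\<close> for integers \<open>k\<close>, so every radius
  below \<open>min 1 (1 / hbar)\<close> yields the same value. The integral converges for \<open>\<bar>Im z\<bar> < pi * (1 + hbar)\<close>.
\<close>

definition qdilog :: "real \<Rightarrow> complex \<Rightarrow> complex" where
  "qdilog hbar z = - (pi * hbar / 2) *
     Omega_integral (min 1 (1 / hbar) / 2)
       (\<lambda>\<xi>. exp (- \<i> * \<xi> * z) / (sinh (pi * \<xi>) * sinh (pi * hbar * \<xi>)))"

end

theory Submission
  imports Defs "HOL-Real_Asymp.Real_Asymp"
begin

text \<open>
  The flip reverses the cyclic order at a single vertex. The boundary walk merely visits the pending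
  edge at another moment, so vertices, edges and the number of boundary cycles are unchanged; and
  the bracket changes by twice the contribution of that vertex.

  Write \<open>P\<close> and \<open>Q\<close> for the terms added to \<open>A\<close> and subtracted from \<open>B\<close>. The reflection formula
  \<open>\<phi>(u) - \<phi>(-u) = u\<close> gives \<open>P = Q + 2 Z\<close>. As \<open>A + B\<close> commutes with \<open>Z\<close>, it commutes with \<open>Q\<close>, and
  hence \<open>[A + P, B - Q] = [A, B] - [A + B, Q] + 2 [Z, B] = [A, B] + 2 [Z, B]\<close>.

  That the dilogarithm may be substituted into \<open>Z\<close> requires polynomial growth of all derivatives on
  horizontal lines. The defining integral is bounded on the left half of the strip \<open>\<bar>Im u\<bar> < pi\<close>; the
  reflection formula, which is a residue computation, extends this to linear growth on the whole
  strip, and Cauchy's inequality bounds the derivatives.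
\<close>

section \<open>Orbits and the flip\<close>

text \<open>A return after one or two steps would give a smaller orbit, so the first three iterates
  fill it. The next iterate must then be \<open>x\<close>, by injectivity.\<close>

lemma orbit_card_3:
  assumes f: "permutation f" and card: "card (orbit f x) = 3"
  shows "f (f (f x)) = x" "f x \<noteq> x" "f (f x) \<noteq> x" "f (f x) \<noteq> f x" "orbit f x = {x, f x, f (f x)}"
proof -
  have inj: "f u = f v \<longleftrightarrow> u = v" for u v
    using permutation_bijective[OF f] by (metis bij_pointE)
  have x: "x \<in> orbit f x"
    by (rule permutation_self_in_orbit[OF f])
  have fin: "finite (orbit f x)"
    using x by (rule finite_orbit)
  have bounded: "orbit f x = {(f ^^ m) x |m. m < n}" if "(f ^^ n) x = x" "0 < n" for n
    using orbit_altdef_bounded that .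
  show 1: "f x \<noteq> x"
    using orbit_eq_singleton_iff[of f x] card by auto
  show 2: "f (f x) \<noteq> x"
  proof
    assume "f (f x) = x"
    with bounded[of 2] have "orbit f x = {(f ^^ m) x |m. m < 2}"
      by (simp add: numeral_2_eq_2)
    also have "\<dots> = (\<lambda>m. (f ^^ m) x) ` {..<2}" by auto
    finally show False
      using card card_image_le[of "{..<2::nat}" "\<lambda>m. (f ^^ m) x"] by simp
  qed
  show 3: "f (f x) \<noteq> f x"
    using 1 inj by metis
  have "{x, f x, f (f x)} \<subseteq> orbit f x"
    using x by (auto intro: orbit.intros)
  moreover have "card {x, f x, f (f x)} = 3"
    using 1 2 3 by auto
  ultimately show 4: "orbit f x = {x, f x, f (f x)}"
    using card fin by (metis card_subset_eq)
  have "f (f (f x)) \<in> orbit f x"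
    by (auto intro: orbit.intros)
  then show "f (f (f x)) = x"
    using 1 2 3 inj unfolding 4 by auto
qed

lemma orbit_mono_step:
  assumes "\<And>y. g y \<in> orbit f y"
  shows "orbit g x \<subseteq> orbit f x"
proof
  fix y assume "y \<in> orbit g x"
  then show "y \<in> orbit f x"
    by induct (use assms orbit_trans in metis)+
qed

text \<open>\<open>g\<close> reaches \<open>c\<close>, the common end point of all excursions of \<open>f\<close> into \<open>D\<close>, by some other way.\<close>

lemma orbit_detour:
  assumes g: "permutation g" and x: "x \<notin> D" and c: "c \<notin> D"
    and leave: "\<And>y. y \<notin> D \<Longrightarrow> f y \<in> D \<Longrightarrow> c \<in> orbit g y"
    and stay: "\<And>y. y \<notin> D \<Longrightarrow> f y \<notin> D \<Longrightarrow> f y \<in> orbit g y"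
    and D: "\<And>y. y \<in> D \<Longrightarrow> f y \<in> insert c D"
  shows "orbit f x - D \<subseteq> orbit g x"
proof -
  \<comment> \<open>The invariant followed along the \<open>f\<close>-walk: during an excursion into
    \<open>D\<close>, the point tracked is the future exit \<open>c\<close> instead of the current
    position.\<close>
  have "if y \<in> D then c \<in> orbit g x else y \<in> orbit g x" if "y \<in> orbit f x" for y
    using that
  proof induct
    case base
    then show ?case using x leave stay by auto
  next
    case (step y)
    show ?case
    proof (cases "y \<in> D")
      case True
      then show ?thesis using step D[of y] c by auto
    next
      case False
      then show ?thesis using step leave[of y] stay[of y] orbit_trans by (metis (full_types))
    qed
  qed
  then show ?thesis by auto
qed

section \<open>Combinatorics of the flip at a pending edge\<close>

locale pending_flip =
  fixes G :: "('h, 'x) fatgraph_scheme" and z :: 'h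
  assumes fat: "fat_graph G"
    and z_dart: "z \<in> darts G"
    and trivalent: "card (vertex_at G z) = 3"
    and pending: "card (vertex_at G (opp G z)) = 1"
begin

abbreviation (input) "a \<equiv> rot G z"
abbreviation (input) "b \<equiv> rot G (rot G z)"
abbreviation (input) "z' \<equiv> opp G z"
abbreviation (input) "G' \<equiv> flip z G"

lemma fin: "finite (darts G)" and rot_permutes: "rot G permutes darts G"
  and opp_permutes: "opp G permutes darts G"
  and opp_neq: "h \<in> darts G \<Longrightarrow> opp G h \<noteq> h" and opp_opp_dart: "h \<in> darts G \<Longrightarrow> opp G (opp G h) = h"
  using fat by (auto simp: fat_graph_def)

lemma opp_opp [simp]: "opp G (opp G h) = h"
  using opp_opp_dart opp_permutes by (cases "h \<in> darts G") (auto simp: permutes_def)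

lemma opp_eq: "opp G h = k \<longleftrightarrow> h = opp G k"
  by (metis opp_opp)

lemma rot_perm: "permutation (rot G)"
  using rot_permutes fin by (auto simp: permutation_permutes)

lemma rot_eq_iff: "rot G h = rot G k \<longleftrightarrow> h = k"
  using permutation_bijective[OF rot_perm] by (metis bij_pointE)

lemma in_vertex_at: "h \<in> vertex_at G h"
  unfolding vertex_at_def by (rule permutation_self_in_orbit[OF rot_perm])

lemma rot_z: "rot G b = z" "a \<noteq> z" "b \<noteq> z" "b \<noteq> a"
  and vertex_at_z: "vertex_at G z = {z, a, b}"
  using orbit_card_3[OF rot_perm trivalent[unfolded vertex_at_def]]
  by (auto simp: vertex_at_def)

lemma rot_univalent: "card (vertex_at G h) = 1 \<Longrightarrow> rot G h = h"
  using orbit_eq_singleton_iff[of "rot G" h] in_vertex_at[of h]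
  by (auto simp: vertex_at_def card_1_singleton_iff)

lemma rot_z': "rot G z' = z'"
  using rot_univalent[OF pending] .

text \<open>The far end \<open>z'\<close> is fixed by \<open>rot G\<close>, whereas the three
  half-edges at the vertex of \<open>z\<close> are moved.\<close>

lemma z'_neq: "z' \<noteq> z" "z' \<noteq> a" "z' \<noteq> b"
  using opp_neq[OF z_dart] rot_z' rot_z by metis+

lemma darts: "a \<in> darts G" "b \<in> darts G" "z' \<in> darts G"
  using z_dart rot_permutes opp_permutes by (simp_all add: permutes_in_image)

lemma rot_flip: "rot G' h = (if h = a then z else if h = z then b else if h = b then a else rot G h)"
  using rot_z by (auto simp: flip_def Let_def)

lemma flip_simps [simp]: "darts G' = darts G" "opp G' = opp G" "orb_order G' = orb_order G"
  by (simp_all add: flip_def Let_def)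

lemma edge_at_flip [simp]: "edge_at G' = edge_at G"
  by (auto simp: edge_at_def fun_eq_iff)

lemma edges_flip [simp]: "edges G' = edges G"
  by (simp add: edges_def)

text \<open>On \<open>{z, a, b}\<close> each of the two rotations is the square of the other;
  elsewhere they agree.\<close>

lemma vertex_at_flip [simp]: "vertex_at G' = vertex_at G"
proof (rule ext)
  fix h
  have orbI: "f x \<in> orbit f x" "f (f x) \<in> orbit f x" for f :: "'h \<Rightarrow> 'h" and x
    by (auto intro: orbit.intros)
  have "rot G' y \<in> orbit (rot G) y" for y
    using orbI[of "rot G" y] rot_z by (auto simp: rot_flip)
  moreover have "rot G y \<in> orbit (rot G') y" for y
    using orbI[of "rot G'" y] rot_z by (auto simp: rot_flip split: if_splits)
  ultimately show "vertex_at G' h = vertex_at G h"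
    unfolding vertex_at_def by (intro equalityI orbit_mono_step)
qed

lemma vertices_flip [simp]: "vertices G' = vertices G"
  by (simp add: vertices_def)

text \<open>Conjugation by the transposition of \<open>z\<close> and \<open>a\<close> reverses the
  3-cycle \<open>(z, a, b)\<close>.\<close>

lemma fat_graph_flip: "fat_graph G'"
proof -
  have "rot G' = Transposition.transpose z a \<circ> rot G \<circ> Transposition.transpose z a"
    using rot_z rot_eq_iff by (auto simp: fun_eq_iff rot_flip Transposition.transpose_def)
  moreover have "Transposition.transpose z a permutes darts G"
    using z_dart darts by (intro permutes_swap_id)
  ultimately have "rot G' permutes darts G'"
    using rot_permutes by (simp add: permutes_compose)
  then show ?thesis
    using fat by (simp add: fat_graph_def)
qed

text \<open>A step of the old rotation stays inside a vertex, hence is a chain of steps of the new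
  one.\<close>

lemma fat_graph_connected_flip:
  assumes "fat_graph_connected G"
  shows "fat_graph_connected G'"
proof -
  let ?R = "{(x, y). y = rot G x \<or> y = opp G x}"
  let ?S = "{(x, y). y = rot G' x \<or> y = opp G' x}"
  have orb: "y \<in> orbit (rot G') x \<Longrightarrow> (x, y) \<in> ?S\<^sup>*" for x y
    by (induct rule: orbit.induct) (auto intro: rtrancl.rtrancl_into_rtrancl)
  have "rot G x \<in> orbit (rot G') x" for x
    using vertex_at_flip by (metis vertex_at_def orbit.base)
  then have "?R \<subseteq> ?S\<^sup>*"
    using orb by auto
  then have "?R\<^sup>* \<subseteq> ?S\<^sup>*"
    by (rule rtrancl_subset_rtrancl)
  then show ?thesis
    using assms by (auto simp: fat_graph_connected_def)
qed

section \<open>Boundary cycles under the flip\<close>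

text \<open>The old walk contains \<open>opp G b\<close>, \<open>z\<close>, \<open>z'\<close>,
  \<open>a\<close> and goes directly from \<open>opp G a\<close> to \<open>b\<close>; the new one
  contains \<open>opp G a\<close>, \<open>z\<close>, \<open>z'\<close>, \<open>b\<close> and goes
  directly from \<open>opp G b\<close> to \<open>a\<close>. All other steps coincide, so the walks
  differ only in when they visit the pending edge.\<close>

lemma boundary_orbit_flip:
  assumes x: "x \<notin> {z, z'}"
  shows "orbit (rot G \<circ> opp G) x - {z, z'} = orbit (rot G' \<circ> opp G) x - {z, z'}"
proof -
  define f where "f = rot G \<circ> opp G"
  define g where "g = rot G' \<circ> opp G"
  have perm: "permutation f" "permutation g"
    using permutation_compose rot_perm fat_graph_flip fin opp_permutes
    unfolding f_def g_def by (metis fat_graph_def permutation_permutes flip_simps(1))+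
  \<comment> \<open>Three iterates are enough: the longest detour passes through \<open>z\<close>
    and \<open>z'\<close> before it returns.\<close>
  have near: "h y \<in> orbit h y" "h (h y) \<in> orbit h y" "h (h (h y)) \<in> orbit h y"
    for h :: "'h \<Rightarrow> 'h" and y
    by (auto intro: orbit.intros)
  have ab: "a \<notin> {z, z'}" "b \<notin> {z, z'}"
    using rot_z z'_neq by auto
  have f: "f z = z'" "f z' = a" "f (opp G a) = b" "f (opp G b) = z"
    using rot_z rot_z' by (simp_all add: f_def)
  have g: "g z = z'" "g z' = b" "g (opp G a) = z" "g (opp G b) = a"
    using rot_z rot_z' z'_neq by (auto simp: g_def rot_flip)
  have other: "g y = f y" "f y \<notin> {z, z'}" if "y \<notin> {z, z', opp G a, opp G b}" for y
    using that rot_z rot_z' rot_eq_iff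
    by (auto simp: f_def g_def rot_flip opp_eq) (metis opp_opp)+
  have "orbit f x - {z, z'} \<subseteq> orbit g x"
  proof (rule orbit_detour[OF perm(2) x ab(1)])
    fix y assume "y \<notin> {z, z'}"
    then consider "y = opp G a" | "y = opp G b" | "y \<notin> {z, z', opp G a, opp G b}" by blast
    then show "f y \<in> {z, z'} \<Longrightarrow> a \<in> orbit g y" "f y \<notin> {z, z'} \<Longrightarrow> f y \<in> orbit g y"
      using near[of g y] f g ab other[of y] by (cases; force)+
  qed (use f in auto)
  moreover have "orbit g x - {z, z'} \<subseteq> orbit f x"
  proof (rule orbit_detour[OF perm(1) x ab(2)])
    fix y assume "y \<notin> {z, z'}"
    then consider "y = opp G a" | "y = opp G b" | "y \<notin> {z, z', opp G a, opp G b}" by blast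
    then show "g y \<in> {z, z'} \<Longrightarrow> b \<in> orbit f y" "g y \<notin> {z, z'} \<Longrightarrow> g y \<in> orbit f y"
      using near[of f y] f g ab other[of y] by (cases; force)+
  qed (use g in auto)
  ultimately show ?thesis
    unfolding f_def g_def by auto
qed

text \<open>Every boundary cycle leaves the pending edge, so deleting its two halves loses no cycle.\<close>

lemma card_orbits_minus_pending:
  assumes f: "f permutes darts G" and z: "f z = z'" "f z' \<notin> {z, z'}"
  shows "card (orbit f ` darts G) = card ((\<lambda>x. orbit f x - {z, z'}) ` (darts G - {z, z'}))"
proof -
  have perm: "permutation f"
    using f fin by (auto simp: permutation_permutes)
  have step: "orbit f (f h) = orbit f h" for h
    by (rule permutation_orbit_step[OF perm])
  have self: "h \<in> orbit f h" for h
    by (rule permutation_self_in_orbit[OF perm])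
  have z'': "f z' \<in> darts G"
    using darts f by (simp add: permutes_in_image)
  have "orbit f ` darts G = orbit f ` (darts G - {z, z'})" (is "?L = ?R")
  proof
    show "?L \<subseteq> ?R"
    proof
      fix C assume "C \<in> ?L"
      then obtain h where h: "h \<in> darts G" "C = orbit f h" by auto
      have "C = orbit f (f z')" if "h = z \<or> h = z'"
        using that step[of z] step[of z'] z h by auto
      then show "C \<in> ?R"
        using h z z'' by blast
    qed
  qed auto
  \<comment> \<open>A punctured orbit still contains its starting point \<open>h\<close>, and orbits
    with a common point are equal.\<close>
  moreover have "inj_on (\<lambda>C. C - {z, z'}) ?R"
  proof (rule inj_onI)
    fix C D assume "C \<in> ?R" "D \<in> ?R" and eq: "C - {z, z'} = D - {z, z'}"
    then obtain h k where h: "h \<notin> {z, z'}" "C = orbit f h" and k: "D = orbit f k" by auto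
    have "h \<in> orbit f k" using self[of h] h eq k by auto
    then show "C = D"
      unfolding h(2) k using cyclic_on_orbit'[OF perm] orbit_cyclic_eq3 by metis
  qed
  ultimately show ?thesis
    by (simp add: card_image[symmetric] image_image)
qed

lemma card_boundary_cycles_flip: "card (boundary_cycles G') = card (boundary_cycles G)"
proof -
  have "(rot G \<circ> opp G) permutes darts G" "(rot G' \<circ> opp G) permutes darts G"
    using permutes_compose[OF opp_permutes] rot_permutes fat_graph_flip by (auto simp: fat_graph_def)
  moreover have "(rot G \<circ> opp G) z = z'" "(rot G' \<circ> opp G) z = z'"
    "(rot G \<circ> opp G) z' \<notin> {z, z'}" "(rot G' \<circ> opp G) z' \<notin> {z, z'}"
    using rot_z z'_neq rot_z' by (auto simp: rot_flip)
  ultimately have "card (orbit (rot G \<circ> opp G) ` darts G) = card (orbit (rot G' \<circ> opp G) ` darts G)"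
    using boundary_orbit_flip by (simp add: card_orbits_minus_pending del: comp_apply cong: image_cong_simp)
  then show ?thesis
    by (simp add: boundary_cycles_def)
qed

lemma spine_flip: "spine g s r G \<Longrightarrow> spine g s r G'"
  by (simp add: spine_def fat_graph_flip fat_graph_connected_flip card_boundary_cycles_flip)

lemma edges_in: "edge_at G z \<in> edges G" "edge_at G a \<in> edges G" "edge_at G b \<in> edges G"
  using z_dart darts by (auto simp: edges_def)

lemma edge_at_eq_iff: "edge_at G h = edge_at G k \<longleftrightarrow> h = k \<or> h = opp G k"
  by (auto simp: edge_at_def doubleton_eq_iff)

end

section \<open>The bracket of the flipped graph\<close>

lemma partial_deriv_coordinate: "partial_deriv e (\<lambda>x. x d) x = of_bool (e = d)"
  by (simp add: partial_deriv_def)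

text \<open>The inner sum of \<open>poisson\<close> for two coordinate functions. The bracket is
  split by vertices because the flip affects only one of them.\<close>

definition vertex_bracket :: "('h, 'x) fatgraph_scheme \<Rightarrow> 'h set \<Rightarrow> 'h set \<Rightarrow> 'h set \<Rightarrow> real" where
  "vertex_bracket G v d e = (\<Sum>h\<in>v.
     of_bool (edge_at G h = d) * of_bool (edge_at G (rot G h) = e)
   - of_bool (edge_at G h = e) * of_bool (edge_at G (rot G h) = d))"

lemma vertex_bracket_swap: "vertex_bracket G v e d = - vertex_bracket G v d e"
  by (simp add: vertex_bracket_def flip: sum_negf)

lemma edge_bracket_eq:
  "edge_bracket G d e = (\<Sum>v\<in>{v \<in> vertices G. card v = 3}. vertex_bracket G v d e)"
  by (simp add: edge_bracket_def poisson_def vertex_bracket_def partial_deriv_coordinate)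

lemma edge_bracket_swap: "edge_bracket G e d = - edge_bracket G d e"
  by (simp add: edge_bracket_eq vertex_bracket_def flip: sum_negf)

context pending_flip
begin

lemma edge_at_neq: "edge_at G z \<noteq> edge_at G a" "edge_at G z \<noteq> edge_at G b"
  using rot_z z'_neq by (auto simp: edge_at_eq_iff) (metis opp_opp)+

text \<open>With three distinct edges, every pair of them is consecutive in exactly one direction.
  If \<open>a\<close> and \<open>b\<close> were the halves of a loop, contributions would
  cancel.\<close>

lemma vertex_bracket_z:
  assumes "edge_at G a \<noteq> edge_at G b"
  shows "vertex_bracket G {z, a, b} (edge_at G z) (edge_at G a) = 1"
    "vertex_bracket G {z, a, b} (edge_at G z) (edge_at G b) = -1"
    "vertex_bracket G {z, a, b} (edge_at G a) (edge_at G b) = 1"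
    "d \<notin> {edge_at G z, edge_at G a, edge_at G b} \<Longrightarrow> vertex_bracket G {z, a, b} d e = 0"
  using rot_z edge_at_neq assms by (auto simp: vertex_bracket_def)

text \<open>Reversing the cyclic order exchanges the members of each consecutive pair, and the
  summand is antisymmetric.\<close>

lemma vertex_bracket_flip:
  "vertex_bracket G' {z, a, b} d e = - vertex_bracket G {z, a, b} d e"
  using rot_z by (simp add: vertex_bracket_def rot_flip)

lemma edge_bracket_vertex_z:
  "edge_bracket G d e = vertex_bracket G {z, a, b} d e +
     (\<Sum>v\<in>{v \<in> vertices G. card v = 3} - {{z, a, b}}. vertex_bracket G v d e)"
proof -
  have "{z, a, b} \<in> {v \<in> vertices G. card v = 3}"
    using trivalent z_dart vertex_at_z by (auto simp: vertices_def)
  moreover have "finite (vertices G)"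
    using fin by (simp add: vertices_def)
  ultimately show ?thesis
    unfolding edge_bracket_eq by (simp add: sum.remove)
qed

text \<open>Vertices are orbits of one permutation, hence equal or disjoint.\<close>

lemma other_vertex:
  assumes "v \<in> vertices G" "v \<noteq> {z, a, b}" "h \<in> v"
  shows "h \<notin> {z, a, b}" "v = vertex_at G h"
proof -
  show v: "v = vertex_at G h"
    using assms orbit_cyclic_eq3[OF cyclic_on_orbit'[OF rot_perm]]
    by (fastforce simp: vertices_def vertex_at_def)
  show "h \<notin> {z, a, b}"
    using assms(2) orbit_cyclic_eq3[OF cyclic_on_orbit'[OF rot_perm]] vertex_at_z
    unfolding v vertex_at_def by metis
qed

lemma edge_bracket_flip:
  "edge_bracket G' d e = edge_bracket G d e - 2 * vertex_bracket G {z, a, b} d e"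
proof -
  have vert: "{z, a, b} \<in> {v \<in> vertices G. card v = 3}" "finite (vertices G)"
    using trivalent z_dart vertex_at_z fin by (auto simp: vertices_def)
  have "vertex_bracket G' v d e = vertex_bracket G v d e" if "v \<in> vertices G" "v \<noteq> {z, a, b}" for v
    using other_vertex(1)[OF that] by (auto simp: vertex_bracket_def rot_flip intro!: sum.cong)
  then have "edge_bracket G' d e = vertex_bracket G' {z, a, b} d e +
     (\<Sum>v\<in>{v \<in> vertices G. card v = 3} - {{z, a, b}}. vertex_bracket G v d e)"
    using vert unfolding edge_bracket_eq by (simp add: sum.remove)
  then show ?thesis
    unfolding edge_bracket_vertex_z[of d e] vertex_bracket_flip by simp
qed

text \<open>One half of the pending edge lies at the vertex of \<open>z\<close>, the other at a
  one-valent vertex, so no further three-valent vertex meets this edge.\<close>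

lemma edge_bracket_pending: "edge_bracket G (edge_at G z) e = vertex_bracket G {z, a, b} (edge_at G z) e"
proof -
  have "vertex_bracket G v (edge_at G z) e = 0" if v: "v \<in> vertices G" "card v = 3" "v \<noteq> {z, a, b}" for v
  proof -
    have "edge_at G h \<noteq> edge_at G z \<and> edge_at G (rot G h) \<noteq> edge_at G z" if h: "h \<in> v" for h
    proof -
      have "h \<notin> {z, a, b}" and vh: "v = vertex_at G h"
        using other_vertex v h by metis+
      moreover have "h \<noteq> z'"
        using vh v pending by auto
      ultimately show ?thesis
        using rot_eq_iff rot_z rot_z' by (auto simp: edge_at_eq_iff) (metis)+
    qed
    then show ?thesis
      by (simp add: vertex_bracket_def)
  qed
  then show ?thesis
    unfolding edge_bracket_vertex_z by simp
qed

end

section \<open>Analytic preliminaries\<close>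

text \<open>Discs of one fixed radius around the points of the line stay in the strip, so Cauchy's
  inequality passes the linear growth on to all derivatives. The values 1, -1 and 0 of
  \<open>a\<close> serve functions of \<open>x\<close>, functions of \<open>- x\<close>, and
  constants.\<close>

lemma tempered_smooth_horizontal:
  fixes f :: "complex \<Rightarrow> complex" and a y :: real
  assumes hol: "f holomorphic_on {w. \<bar>Im w\<bar> < R}"
    and bound: "\<And>w. \<bar>Im w\<bar> < R \<Longrightarrow> norm (f w) \<le> C * (1 + norm w)"
    and y: "\<bar>y\<bar> < R" and a: "\<bar>a\<bar> \<le> 1"
  shows "tempered_smooth (\<lambda>x. f (of_real (a * x) + \<i> * of_real y))"
proof -
  let ?S = "{w. \<bar>Im w\<bar> < R}"
  let ?p = "\<lambda>x::real. of_real (a * x) + \<i> * of_real y :: complex"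
  let ?D = "\<lambda>k x. of_real a ^ k * (deriv ^^ k) f (?p x)"
  have "?S = {w. Im w < R} \<inter> {w. - R < Im w}" by auto
  then have "open ?S"
    using open_Int[OF open_halfspace_Im_lt[of R] open_halfspace_Im_gt[of "- R"]] by simp
  have pS: "?p x \<in> ?S" for x using y by simp
  have "(?D k has_vector_derivative ?D (Suc k) x) (at x)" for k x
  proof -
    have "(deriv ^^ k) f holomorphic_on ?S"
      using hol \<open>open ?S\<close> by (rule holomorphic_higher_deriv)
    then have "((deriv ^^ k) f has_field_derivative (deriv ^^ Suc k) f (?p x)) (at (?p x))"
      using holomorphic_derivI[OF _ \<open>open ?S\<close> pS] by simp
    moreover have "(?p has_vector_derivative of_real a) (at x)"
      by (auto intro!: derivative_eq_intros simp: has_vector_derivative_def scaleR_conv_of_real)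
    ultimately have "((deriv ^^ k) f \<circ> ?p has_vector_derivative of_real a * (deriv ^^ Suc k) f (?p x)) (at x)"
      by (rule field_vector_diff_chain_at[rotated])
    then show ?thesis
      using has_vector_derivative_mult_right[of _ _ _ "of_real a ^ k"]
      by (fastforce simp: o_def mult_ac)
  qed
  moreover have "\<exists>A n. \<forall>x. norm (?D k x) \<le> A * (1 + \<bar>x\<bar>) ^ n" for k
  proof -
    \<comment> \<open>Half the distance from the line to the boundary of the strip, so that even the
      closed discs lie inside.\<close>
    define r where "r = (R - \<bar>y\<bar>) / 2"
    have r: "0 < r" "\<bar>y\<bar> + r < R" using y by (auto simp: r_def field_simps)
    have "norm (?D k x) \<le> (fact k * (\<bar>C\<bar> * (1 + R)) / r ^ k) * (1 + \<bar>x\<bar>) ^ 1" for x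
    proof -
      have sub: "cball (?p x) r \<subseteq> ?S"
      proof
        fix w assume "w \<in> cball (?p x) r"
        then have "\<bar>Im (w - ?p x)\<bar> \<le> r"
          using abs_Im_le_cmod[of "w - ?p x"] by (simp add: dist_norm norm_minus_commute)
        then show "w \<in> ?S" using r(2) by simp
      qed
      have ax: "\<bar>a * x\<bar> \<le> \<bar>x\<bar>"
        using mult_right_mono[OF a, of "\<bar>x\<bar>"] by (simp add: abs_mult)
      have "norm ((deriv ^^ k) f (?p x)) \<le> fact k * (\<bar>C\<bar> * (1 + R) * (1 + \<bar>x\<bar>)) / r ^ k"
      proof (rule Cauchy_inequality[OF _ _ r(1)])
        show "f holomorphic_on ball (?p x) r"
          using hol sub ball_subset_cball by (meson holomorphic_on_subset order_trans)
        show "continuous_on (cball (?p x) r) f"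
          using hol sub holomorphic_on_imp_continuous_on holomorphic_on_subset by blast
        fix w assume w: "norm (?p x - w) = r"
        then have "w \<in> ?S" using sub by (auto simp: dist_norm)
        have "norm w \<le> norm (?p x) + r"
          using w norm_triangle_ineq4[of "?p x" "?p x - w"] by simp
        also have "norm (?p x) \<le> \<bar>a * x\<bar> + \<bar>y\<bar>"
          by (rule order_trans[OF norm_triangle_ineq]) (simp add: norm_mult)
        finally have "1 + norm w \<le> 1 + (\<bar>x\<bar> + R)"
          using ax r by simp
        also have "\<dots> \<le> (1 + R) * (1 + \<bar>x\<bar>)"
          using y by (simp add: algebra_simps)
        finally have 1: "1 + norm w \<le> (1 + R) * (1 + \<bar>x\<bar>)" .
        have "norm (f w) \<le> C * (1 + norm w)"
          using bound \<open>w \<in> ?S\<close> by auto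
        also have "\<dots> \<le> \<bar>C\<bar> * ((1 + R) * (1 + \<bar>x\<bar>))"
          using 1 by (intro mult_mono) auto
        finally show "norm (f w) \<le> \<bar>C\<bar> * (1 + R) * (1 + \<bar>x\<bar>)"
          by (simp add: mult.assoc)
      qed
      moreover have "\<bar>a\<bar> ^ k \<le> 1"
        using a by (simp add: power_le_one)
      ultimately have "\<bar>a\<bar> ^ k * norm ((deriv ^^ k) f (?p x)) \<le> 1 * (fact k * (\<bar>C\<bar> * (1 + R) * (1 + \<bar>x\<bar>)) / r ^ k)"
        by (intro mult_mono) auto
      then show ?thesis
        by (simp add: norm_mult norm_power field_simps)
    qed
    then show ?thesis by blast
  qed
  ultimately show ?thesis
    unfolding tempered_smooth_def by (intro exI[of _ ?D]) auto
qed

section \<open>Laplace-type integrals in a half-plane\<close>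

text \<open>For \<open>Im z \<le> R\<close> the exponential factor is at most
  \<open>exp (R * x)\<close>, so the integrand is dominated by
  \<open>K * exp (- (c - R) * x)\<close>. Neither bound depends on \<open>z\<close>.\<close>

lemma laplace_tail:
  fixes m :: "real \<Rightarrow> complex"
  assumes a: "0 \<le> a" and R: "R < c"
    and cont: "continuous_on {a..} m"
    and bound: "\<And>x. a \<le> x \<Longrightarrow> norm (m x) \<le> K * exp (- c * x)"
    and z: "Im z \<le> R" and d: "a \<le> d"
  shows "set_integrable lborel {d..} (\<lambda>x. exp (- \<i> * of_real x * z) * m x)"
    and "norm (LBINT x:{d..}. exp (- \<i> * of_real x * z) * m x) \<le> K * exp ((R - c) * d) / (c - R)"
proof -
  let ?g = "\<lambda>x. K * exp (- (c - R) * x)"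
  let ?f = "\<lambda>x. exp (- \<i> * of_real x * z) * m x"
  have K: "0 \<le> K"
    using bound[of a] norm_ge_zero[of "m a"]
    by (meson exp_gt_zero order_refl order_trans zero_le_mult_iff not_less)
  have int_g: "(?g has_integral K * (exp (- (c - R) * d) / (c - R))) {d..}"
    using R by (intro has_integral_mult_right has_integral_exp_minus_to_infinity) simp
  then have "?g absolutely_integrable_on {d..}"
    using K by (intro nonnegative_absolutely_integrable_1) (auto simp: has_integral_integrable)
  then have g: "set_integrable lborel {d..} ?g"
    by (simp add: set_integrable_def integrable_completion)
  have le: "norm (?f x) \<le> ?g x" if "x \<in> {d..}" for x
  proof -
    have "x * Im z \<le> x * R"
      using that a d z by (intro mult_left_mono) auto
    then have "norm (exp (- \<i> * of_real x * z)) \<le> exp (R * x)"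
      by (simp add: norm_exp_eq_Re mult.commute)
    moreover have "norm (m x) \<le> K * exp (- c * x)"
      using that d bound by auto
    ultimately have "norm (?f x) \<le> exp (R * x) * (K * exp (- c * x))"
      unfolding norm_mult by (intro mult_mono) auto
    also have "\<dots> = ?g x"
      by (simp add: algebra_simps flip: exp_add)
    finally show ?thesis .
  qed
  have "continuous_on {d..} ?f"
    using d by (intro continuous_intros continuous_on_subset[OF cont]) auto
  then have meas: "set_borel_measurable lborel {d..} ?f"
    using borel_measurable_continuous_on_indicator[of "{d..}" ?f]
    by (simp add: set_borel_measurable_def)
  show f: "set_integrable lborel {d..} ?f"
    by (rule set_integrable_bound[OF g meas])
      (intro AE_I2 impI order_trans[OF le], simp_all only: real_norm_def abs_ge_self)
  have "norm (LBINT x:{d..}. ?f x) \<le> (LBINT x:{d..}. ?g x)"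
    unfolding set_lebesgue_integral_def
    by (rule Bochner_Integration.integral_norm_bound_integral)
      (use f g le in \<open>auto simp: set_integrable_def indicator_def\<close>)
  also have "\<dots> = integral {d..} ?g"
    using set_borel_integral_eq_integral(2)[OF g] .
  also have "\<dots> = K * (exp (- (c - R) * d) / (c - R))"
    using int_g by (rule integral_unique)
  also have "\<dots> = K * exp ((R - c) * d) / (c - R)"
    by simp
  finally show "norm (LBINT x:{d..}. ?f x) \<le> K * exp ((R - c) * d) / (c - R)" .
qed

text \<open>The truncated integrals are holomorphic by differentiation under the integral sign, and
  by \<open>laplace_tail\<close> they converge uniformly on the half-plane.\<close>

lemma laplace_holomorphic:
  fixes m :: "real \<Rightarrow> complex"
  assumes a: "0 \<le> a" and R: "R < c"
    and cont: "continuous_on {a..} m"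
    and bound: "\<And>x. a \<le> x \<Longrightarrow> norm (m x) \<le> K * exp (- c * x)"
  shows "(\<lambda>z. LBINT x:{a..}. exp (- \<i> * of_real x * z) * m x) holomorphic_on {z. Im z < R}"
proof (rule holomorphic_uniform_sequence)
  let ?F = "\<lambda>z x. exp (- \<i> * of_real x * z) * m x"
  let ?S = "{z. Im z < R}"
  let ?f = "\<lambda>(n::nat) z. integral {a..a + n} (?F z)"
  show "open ?S" by (rule open_halfspace_Im_lt)
  have tail: "set_integrable lborel {d..} (?F z)"
    "norm (LBINT x:{d..}. ?F z x) \<le> K * exp ((R - c) * d) / (c - R)" if "Im z \<le> R" "a \<le> d" for z d
    using laplace_tail[OF a R cont bound that] by blast+
  show "?f n holomorphic_on ?S" for n
    unfolding cbox_interval[symmetric]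
  proof (rule leibniz_rule_holomorphic)
    show "((\<lambda>z. ?F z t) has_field_derivative - \<i> * of_real t * ?F z t) (at z within ?S)" for z t
      by (auto intro!: derivative_eq_intros)
    have m: "continuous_on (cbox a (a + n)) m"
      by (rule continuous_on_subset[OF cont]) auto
    show "?F z integrable_on cbox a (a + n)" for z
      by (intro integrable_continuous continuous_intros m)
    have "continuous_on (?S \<times> cbox a (a + n)) (\<lambda>p. m (snd p))"
      by (rule continuous_on_compose2[OF m]) (auto intro!: continuous_intros)
    then show "continuous_on (?S \<times> cbox a (a + n)) (\<lambda>(z, t). - \<i> * of_real t * ?F z t)"
      by (auto simp: case_prod_unfold intro!: continuous_intros)
    show "convex ?S" by (rule convex_halfspace_Im_lt)
  qed
  fix w assume "w \<in> ?S"
  then obtain d where d: "0 < d" "cball w d \<subseteq> ?S"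
    using \<open>open ?S\<close> open_contains_cball by blast
  have split: "(LBINT x:{a..}. ?F z x) - ?f n z = (LBINT x:{a + n..}. ?F z x)" if "z \<in> ?S" for z n
  proof -
    have "Im z \<le> R" using that by simp
    note i = tail(1)[OF this]
    have i1: "set_integrable lborel {a..<a + n} (?F z)"
      by (rule set_integrable_subset[OF i[of a]]) auto
    \<comment> \<open>Half-open intervals make the pieces disjoint; the missing end point is a null
      set.\<close>
    have "{a..} = {a..<a + n} \<union> {a + n..}" by auto
    then have "(LBINT x:{a..}. ?F z x) = (LBINT x:{a..<a + n}. ?F z x) + (LBINT x:{a + n..}. ?F z x)"
      using set_integral_Un[OF _ i1 i[of "a + n"]] by fastforce
    moreover have "(LBINT x:{a..<a + n}. ?F z x) = integral {a..<a + n} (?F z)"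
      using set_borel_integral_eq_integral(2)[OF i1] .
    moreover have "\<dots> = ?f n z"
      by (rule integral_subset_negligible)
        (auto intro!: negligible_subset[OF negligible_sing[of "a + n"]])
    ultimately show ?thesis by simp
  qed
  have "uniform_limit ?S ?f (\<lambda>z. LBINT x:{a..}. ?F z x) sequentially"
    unfolding uniform_limit_sequentially_iff
  proof (intro allI impI)
    fix e :: real assume "0 < e"
    have "(\<lambda>n. K * exp ((R - c) * (a + real n)) / (c - R)) \<longlonglongrightarrow> 0"
      using R by real_asymp
    from order_tendstoD(2)[OF this \<open>0 < e\<close>]
    obtain N where N: "\<And>n. N \<le> n \<Longrightarrow> K * exp ((R - c) * (a + real n)) / (c - R) < e"
      unfolding eventually_sequentially by blast
    have "dist (?f n z) (LBINT x:{a..}. ?F z x) < e" if "z \<in> ?S" "N \<le> n" for n z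
    proof -
      have "dist (?f n z) (LBINT x:{a..}. ?F z x) = norm (LBINT x:{a + n..}. ?F z x)"
        unfolding split[OF that(1), symmetric] dist_norm by (rule norm_minus_commute)
      also have "\<dots> \<le> K * exp ((R - c) * (a + n)) / (c - R)"
        using that(1) by (intro tail(2)) auto
      finally show ?thesis
        using N[OF that(2)] by simp
    qed
    then show "\<exists>N. \<forall>n\<ge>N. \<forall>z\<in>?S. dist (?f n z) (LBINT x:{a..}. ?F z x) < e"
      by blast
  qed
  then show "\<exists>d>0. cball w d \<subseteq> ?S \<and> uniform_limit (cball w d) ?f (\<lambda>z. LBINT x:{a..}. ?F z x) sequentially"
    using d uniform_limit_on_subset by blast
qed

section \<open>The hyperbolic sine\<close>

lemma sinh_of_real_complex: "sinh (of_real x :: complex) = of_real (sinh x)"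
  by (simp add: sinh_field_def exp_of_real flip: of_real_minus)

lemma cnj_sinh: "cnj (sinh u) = sinh (cnj u)"
  by (simp add: sinh_field_def exp_cnj)

text \<open>The zeros of \<open>sinh\<close> are the integer multiples of
  \<open>\<i> * pi\<close>.\<close>

lemma sinh_nonzero:
  fixes u :: complex
  assumes "u \<noteq> 0" "norm u < pi"
  shows "sinh u \<noteq> 0"
proof
  assume "sinh u = 0"
  then have "exp (2 * u) = 1"
    by (auto simp: sinh_zero_iff exp_double)
  then obtain n :: int where n: "Re u = 0" "Im u = of_int n * pi"
    by (auto simp: exp_eq_1)
  then have "norm u = \<bar>of_int n\<bar> * pi"
    by (simp add: cmod_eq_Im abs_mult)
  moreover have "n \<noteq> 0"
    using n assms(1) by (auto simp: complex_eq_iff)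
  then have "1 \<le> \<bar>of_int n :: real\<bar>"
    by linarith
  then have "1 * pi \<le> \<bar>of_int n\<bar> * pi"
    by (intro mult_right_mono) auto
  ultimately show False
    using assms(2) by simp
qed

text \<open>In \<open>sinh x = (1 - exp (- 2 * x)) / 2 * exp x\<close> the first factor increases
  with \<open>x\<close>. This gives the exponential decay of the integrand on the rays.\<close>

lemma sinh_lower_bound:
  fixes x d :: real
  assumes "d \<le> x"
  shows "(1 - exp (- 2 * d)) / 2 * exp x \<le> sinh x"
proof -
  have "exp (- x) = exp (- 2 * x) * exp x"
    by (simp flip: exp_add)
  also have "\<dots> \<le> exp (- 2 * d) * exp x"
    using assms by (intro mult_right_mono) auto
  finally show ?thesis
    by (simp add: sinh_field_def field_simps)
qed

text \<open>Differentiating \<open>f (- u) = f u\<close> at 0 shows that the derivative equals its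
  own negative.\<close>

lemma deriv_even_at_0:
  fixes f :: "complex \<Rightarrow> complex"
  assumes even: "\<And>u. f (- u) = f u" and diff: "f field_differentiable at 0"
  shows "deriv f 0 = 0"
proof -
  have f: "(f has_field_derivative deriv f 0) (at 0)"
    using diff by (rule field_differentiable_derivI)
  then have "((\<lambda>u. f (- u)) has_field_derivative deriv f 0 * - 1) (at 0)"
    by (intro DERIV_chain2[where f = f and g = uminus]) (auto intro!: derivative_eq_intros)
  then have "deriv f 0 = - deriv f 0"
    using f DERIV_unique unfolding even by fastforce
  then show ?thesis by simp
qed

lemma cis_shift: "cis (t + pi) = - cis t" "cis (pi - t) = - cnj (cis t)"
  by (simp_all add: complex_eq_iff)

text \<open>The entire extension of \<open>sinh u / u\<close>, used to split the double pole at the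
  origin off the dilogarithm's integrand.\<close>

definition sinhc :: "complex \<Rightarrow> complex" where
  "sinhc u = (if u = 0 then 1 else sinh u / u)"

lemma sinhc_holomorphic: "sinhc holomorphic_on UNIV"
proof (rule pole_theorem_open_0[where g = sinh and a = 0])
  have "(\<lambda>u::complex. sinh u) holomorphic_on UNIV"
    by (simp add: sinh_field_def holomorphic_intros)
  then show "sinh holomorphic_on (UNIV :: complex set)" .
  show "sinhc 0 = deriv sinh 0"
    by (simp add: sinhc_def DERIV_imp_deriv[OF has_field_derivative_sinh[OF DERIV_ident]])
qed (auto simp: sinhc_def)

lemma sinhc_minus [simp]: "sinhc (- u) = sinhc u"
  by (simp add: sinhc_def)

lemma sinhc_nonzero: "norm u < pi \<Longrightarrow> sinhc u \<noteq> 0"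
  using sinh_nonzero by (auto simp: sinhc_def)

section \<open>The quantum dilogarithm\<close>

locale dilog =
  fixes h :: real
  assumes h: "0 < h"
begin

text \<open>The radius used in \<open>qdilog\<close>: half the distance from the origin to the
  nearest other pole.\<close>

definition eps :: real where "eps = min 1 (1 / h) / 2"

definition weight :: "complex \<Rightarrow> complex" where
  "weight \<xi> = 1 / (sinh (of_real pi * \<xi>) * sinh (of_real (pi * h) * \<xi>))"

definition ray :: "complex \<Rightarrow> complex" where
  "ray z = (LBINT x:{eps..}. exp (- \<i> * of_real x * z) * weight (of_real x))"

definition arc_integrand :: "complex \<Rightarrow> real \<Rightarrow> complex" where
  "arc_integrand z t = exp (- \<i> * (eps * cis t) * z) * weight (eps * cis t) * eps * \<i> * cis t"

text \<open>Runs counterclockwise, against the direction of the half-circle in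
  \<open>Omega_integral\<close>; hence its minus sign in \<open>qdilog_eq\<close>.\<close>

definition arc :: "complex \<Rightarrow> complex" where
  "arc z = integral {0..pi} (arc_integrand z)"

lemma eps: "0 < eps" "eps < 1" "h * eps < 1"
proof -
  show "0 < eps" "eps < 1" using h by (auto simp: eps_def)
  have "2 * eps \<le> 1 / h" by (simp add: eps_def)
  then show "h * eps < 1" using h by (simp add: field_simps)
qed

lemma scaled_small:
  fixes \<xi> :: complex
  assumes "norm \<xi> \<le> eps"
  shows "norm (of_real pi * \<xi>) < pi" "norm (of_real (pi * h) * \<xi>) < pi"
proof -
  show "norm (of_real pi * \<xi>) < pi" using assms eps by (simp add: norm_mult)
  have "h * norm \<xi> \<le> h * eps" using assms h by simp
  then have "h * norm \<xi> < 1" using eps by simp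
  then show "norm (of_real (pi * h) * \<xi>) < pi" using h by (simp add: norm_mult mult.assoc abs_mult)
qed

lemma weight_minus [simp]: "weight (- \<xi>) = weight \<xi>"
  by (simp add: weight_def)

lemma cnj_weight: "cnj (weight \<xi>) = weight (cnj \<xi>)"
  by (simp add: weight_def cnj_sinh)

text \<open>Since \<open>weight\<close> is even, the substitution of \<open>- \<xi>\<close> for
  \<open>\<xi>\<close> carries the left ray to the right one and \<open>z\<close> to
  \<open>- z\<close>.\<close>

lemma qdilog_eq: "qdilog h z = - (pi * h / 2) * (ray z + ray (- z) - arc z)"
proof -
  let ?F = "\<lambda>\<xi>. exp (- \<i> * \<xi> * z) / (sinh (of_real pi * \<xi>) * sinh (of_real (pi * h) * \<xi>))"
  have F: "?F \<xi> = exp (- \<i> * \<xi> * z) * weight \<xi>" for \<xi>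
    by (simp add: weight_def)
  have "(LBINT x:{..- eps}. ?F (of_real x)) = (LBINT x:{x. - x \<in> {..- eps}}. ?F (of_real (- x)))"
    by (rule set_integral_reflect)
  also have "{x. - x \<in> {..- eps}} = {eps..}" by auto
  finally have "(LBINT x:{..- eps}. ?F (of_real x)) = ray (- z)"
    unfolding F ray_def by simp
  moreover have "(LBINT x:{eps..}. ?F (of_real x)) = ray z"
    unfolding F ray_def by simp
  moreover have "contour_integral (part_circlepath 0 eps pi 0) ?F = - arc z"
    unfolding F arc_def arc_integrand_def
    by (subst contour_integral_part_circlepath_reverse')
      (simp_all add: contour_integral_part_circlepath_eq)
  ultimately show ?thesis
    unfolding qdilog_def Omega_integral_def eps_def by simp
qed

section \<open>Conjugation and reflection of the dilogarithm\<close>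

lemma cnj_ray: "cnj (ray z) = ray (- cnj z)"
  unfolding ray_def set_lebesgue_integral_def
  by (subst Bochner_Integration.integral_cnj[symmetric])
    (simp add: exp_cnj cnj_weight scaleR_conv_of_real del: Bochner_Integration.integral_cnj)

text \<open>The map from \<open>\<xi>\<close> to \<open>- cnj \<xi>\<close> preserves the upper
  half-circle; in the parameter it is \<open>t\<close> to \<open>pi - t\<close>.\<close>

lemma cnj_arc: "cnj (arc z) = arc (cnj z)"
proof -
  have "cnj (arc z) = integral {0..pi} (\<lambda>t. cnj (arc_integrand z t))"
    unfolding arc_def by (rule Henstock_Kurzweil_Integration.integral_cnj)
  also have "(\<lambda>t. cnj (arc_integrand z t)) = (\<lambda>t. arc_integrand (cnj z) (pi - t))"
    unfolding arc_integrand_def cis_shift(2)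
    by (simp add: fun_eq_iff exp_cnj cnj_weight)
  also have "integral {0..pi} \<dots> = integral {-pi..-0} (\<lambda>t. arc_integrand (cnj z) (pi + t))"
    using Henstock_Kurzweil_Integration.integral_reflect_real[of "pi" 0 "\<lambda>t. arc_integrand (cnj z) (pi + t)"]
    using Henstock_Kurzweil_Integration.integral_reflect_real[of 0 "-pi" "\<lambda>t. arc_integrand (cnj z) (pi + t)"]
    by simp
  also have "\<dots> = arc (cnj z)"
    using integral_shift_Icc_real[of "-pi" 0 "arc_integrand (cnj z)" pi]
    by (simp add: arc_def o_def)
  finally show ?thesis .
qed

text \<open>Conjugation interchanges the two ray terms. This identity yields self-adjointness of the
  transformed generators.\<close>

lemma cnj_qdilog: "cnj (qdilog h z) = qdilog h (cnj z)"
  by (simp add: qdilog_eq cnj_ray cnj_arc)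

lemma weight_nonzero:
  fixes \<xi> :: complex
  assumes "norm \<xi> \<le> eps" "\<xi> \<noteq> 0"
  shows "sinh (of_real pi * \<xi>) \<noteq> 0" "sinh (of_real (pi * h) * \<xi>) \<noteq> 0"
  using scaled_small[OF assms(1)] assms(2) h by (intro sinh_nonzero; simp)+

lemma weight_arc_continuous: "continuous_on A (\<lambda>t. weight (eps * cis t))"
  unfolding weight_def using eps weight_nonzero[of "eps * cis t" for t]
  by (intro continuous_intros) (auto simp: norm_mult)

lemma arc_integrand_continuous: "continuous_on A (arc_integrand z)"
  unfolding arc_integrand_def by (intro continuous_intros weight_arc_continuous)

text \<open>
  The two half-circles form a circle around the origin, where the integrand has residue
  \<open>- \<i> * z / (pi\<^sup>2 * h)\<close>.
\<close>

lemma arc_reflect: "arc z - arc (- z) = 2 * z / (pi * h)"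
proof -
  let ?F = "\<lambda>\<xi>. exp (- \<i> * \<xi> * z) * weight \<xi>"
  \<comment> \<open>The regular factor: \<open>weight \<xi> = k \<xi> / \<xi>\<^sup>2\<close> near
    0, away from 0 itself.\<close>
  define k where "k \<xi> = 1 / (of_real (pi * (pi * h)) * (sinhc (of_real pi * \<xi>) * sinhc (of_real (pi * h) * \<xi>)))" for \<xi>
  let ?f = "\<lambda>\<xi>. exp (- \<i> * \<xi> * z) * k \<xi>"
  have circle: "contour_integral (circlepath 0 eps) ?F = arc z - arc (- z)"
  proof -
    have "integral {pi..2 * pi} (arc_integrand z) = integral {0..pi} (\<lambda>t. arc_integrand z (t + pi))"
      using integral_shift_Icc_real[of 0 pi "arc_integrand z" pi] by (simp add: o_def add.commute)
    also have "(\<lambda>t. arc_integrand z (t + pi)) = (\<lambda>t. - arc_integrand (- z) t)"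
      by (simp add: arc_integrand_def cis_shift fun_eq_iff)
    finally have "integral {pi..2 * pi} (arc_integrand z) = - arc (- z)"
      by (simp add: arc_def)
    moreover have "integral {0..pi} (arc_integrand z) + integral {pi..2 * pi} (arc_integrand z)
        = integral {0..2 * pi} (arc_integrand z)"
      by (intro Henstock_Kurzweil_Integration.integral_combine integrable_continuous_interval
          arc_integrand_continuous) auto
    moreover have "contour_integral (circlepath 0 eps) ?F = integral {0..2 * pi} (arc_integrand z)"
      unfolding circlepath_def arc_integrand_def
      by (subst contour_integral_part_circlepath_eq) simp_all
    ultimately show ?thesis by (simp add: arc_def)
  qed
  have k: "k field_differentiable at \<xi>" if "norm \<xi> \<le> eps" for \<xi>
  proof -
    have "(\<lambda>\<xi>. sinhc (of_real c * \<xi>)) field_differentiable at \<xi>" for c :: real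
      using holomorphic_on_imp_differentiable_at[OF sinhc_holomorphic open_UNIV]
      by (intro field_differentiable_compose[of "\<lambda>\<xi>. of_real c * \<xi>" _ sinhc, unfolded o_def])
        (auto intro!: derivative_intros field_differentiable_mult)
    from this[of pi] this[of "pi * h"] show ?thesis
      unfolding k_def using scaled_small[OF that] h
      by (intro field_differentiable_divide field_differentiable_mult field_differentiable_const)
        (auto simp: sinhc_nonzero)
  qed
  \<comment> \<open>As \<open>k\<close> is even, only the exponential contributes to the derivative
    of \<open>?f\<close> at 0.\<close>
  have "deriv k 0 = 0"
    by (rule deriv_even_at_0) (use eps k in \<open>auto simp: k_def\<close>)
  then have "(k has_field_derivative 0) (at 0)"
    using field_differentiable_derivI[OF k[of 0]] eps by simp
  then have "(?f has_field_derivative (- \<i> * z * k 0)) (at 0)"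
    by (auto intro!: derivative_eq_intros)
  then have df: "deriv ?f 0 = - \<i> * z / (of_real pi * (of_real pi * of_real h))"
    by (simp add: DERIV_imp_deriv k_def sinhc_def)
  have f: "?f field_differentiable at \<xi>" if "norm \<xi> \<le> eps" for \<xi>
    by (intro field_differentiable_mult k that holomorphic_on_imp_differentiable_at[where s = UNIV])
      (auto intro!: holomorphic_intros)
  have "contour_integral (circlepath 0 eps) ?F = contour_integral (circlepath 0 eps) (\<lambda>u. ?f u / (u - 0)\<^sup>2)"
  proof (rule contour_integral_cong[OF refl])
    fix u assume "u \<in> path_image (circlepath 0 eps)"
    then have "u \<noteq> 0" using eps by auto
    then show "?F u = ?f u / (u - 0)\<^sup>2"
      using h by (simp add: weight_def k_def sinhc_def power2_eq_square)
  qed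
  \<comment> \<open>Cauchy's formula for the first derivative evaluates the residue at the double
    pole.\<close>
  also have "\<dots> = 2 * pi * \<i> * deriv ?f 0"
  proof (rule Cauchy_contour_integral_circlepath_2)
    show "continuous_on (cball 0 eps) ?f"
      using f by (intro continuous_at_imp_continuous_on ballI field_differentiable_imp_continuous_at) auto
    show "?f holomorphic_on ball 0 eps"
      using f by (auto simp: holomorphic_on_def intro: field_differentiable_at_within)
  qed (use eps in auto)
  also have "\<dots> = 2 * z / (pi * h)"
    unfolding df using h by (simp add: field_simps)
  finally show ?thesis
    using circle by simp
qed

text \<open>The ray terms are symmetric in \<open>z\<close> and \<open>- z\<close>, so only the
  half-circles remain.\<close>

lemma qdilog_reflect: "qdilog h z - qdilog h (- z) = z"
proof -
  have "qdilog h z - qdilog h (- z) = (pi * h / 2) * (arc z - arc (- z))"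
    by (simp add: qdilog_eq algebra_simps)
  then show ?thesis
    unfolding arc_reflect using h by simp
qed

section \<open>Holomorphy and growth in the strip\<close>

lemma weight_ray_bound:
  obtains K where "\<And>x. eps \<le> x \<Longrightarrow> norm (weight (of_real x)) \<le> K * exp (- (pi + pi * h) * x)"
proof
  \<comment> \<open>The factor of \<open>sinh_lower_bound\<close> at the start of the ray, where
    \<open>x = eps\<close>.\<close>
  define c where "c = (\<lambda>p. (1 - exp (- 2 * (p * eps))) / 2)"
  have c: "0 < c p" if "0 < p" for p
    using that eps by (simp add: c_def)
  fix x :: real assume x: "eps \<le> x"
  have sinh: "c p * exp (p * x) \<le> sinh (p * x)" if "0 < p" for p
    unfolding c_def using that x by (intro sinh_lower_bound) simp
  have pos: "0 < c pi" "0 < c (pi * h)" using c h by auto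
  have "c pi * exp (pi * x) * (c (pi * h) * exp (pi * h * x)) \<le> sinh (pi * x) * sinh (pi * h * x)"
    using sinh[of pi] sinh[of "pi * h"] h pos x eps by (intro mult_mono) (auto simp: mult.assoc intro: order_trans[rotated])
  moreover have "weight (of_real x) = of_real (1 / (sinh (pi * x) * sinh (pi * h * x)))"
    by (simp add: weight_def flip: sinh_of_real_complex)
  moreover have "0 < c pi * exp (pi * x) * (c (pi * h) * exp (pi * h * x))"
    using pos by simp
  ultimately have "norm (weight (of_real x)) \<le> 1 / (c pi * exp (pi * x) * (c (pi * h) * exp (pi * h * x)))"
    by (simp only: norm_of_real) (simp add: frac_le)
  also have "\<dots> = 1 / (c pi * c (pi * h)) * inverse (exp (pi * x) * exp (pi * h * x))"
    by (simp add: divide_inverse mult_ac)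
  also have "inverse (exp (pi * x) * exp (pi * h * x)) = exp (- (pi + pi * h) * x)"
    by (simp add: algebra_simps flip: exp_add exp_minus)
  finally show "norm (weight (of_real x)) \<le> 1 / (c pi * c (pi * h)) * exp (- (pi + pi * h) * x)" .
qed

lemma weight_ray_continuous: "continuous_on {eps..} (\<lambda>x. weight (of_real x))"
proof -
  have eq: "(\<lambda>x. weight (of_real x)) = (\<lambda>x. of_real (1 / (sinh (pi * x) * sinh (pi * h * x))))"
    by (simp add: weight_def fun_eq_iff flip: sinh_of_real_complex)
  show ?thesis
    unfolding eq using eps h by (intro continuous_intros) auto
qed

text \<open>The weight decays at rate \<open>pi + pi * h\<close>, which leaves a margin of
  \<open>pi * h\<close> when \<open>Im z \<le> pi\<close>.\<close>

lemma ray_holomorphic: "ray holomorphic_on {z. Im z < pi}"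
  and ray_bounded: "\<exists>B. \<forall>z. Im z \<le> pi \<longrightarrow> norm (ray z) \<le> B"
proof -
  obtain K where K: "\<And>x. eps \<le> x \<Longrightarrow> norm (weight (of_real x)) \<le> K * exp (- (pi + pi * h) * x)"
    using weight_ray_bound by blast
  have le: "0 \<le> eps" "pi < pi + pi * h" using eps h by auto
  note cont = weight_ray_continuous
  show "ray holomorphic_on {z. Im z < pi}"
    using laplace_holomorphic[OF le cont K] unfolding ray_def by blast
  have "norm (ray z) \<le> K * exp ((pi - (pi + pi * h)) * eps) / (pi + pi * h - pi)" if "Im z \<le> pi" for z
    using laplace_tail(2)[OF le cont K that order_refl] unfolding ray_def by blast
  then show "\<exists>B. \<forall>z. Im z \<le> pi \<longrightarrow> norm (ray z) \<le> B" by blast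
qed

lemma arc_holomorphic: "arc holomorphic_on UNIV"
  unfolding arc_def cbox_interval[symmetric]
proof (rule leibniz_rule_holomorphic)
  show "((\<lambda>z. arc_integrand z t) has_field_derivative - \<i> * (eps * cis t) * arc_integrand z t) (at z within UNIV)"
    for z t
    unfolding arc_integrand_def by (auto intro!: derivative_eq_intros)
  show "arc_integrand z integrable_on cbox 0 pi" for z
    by (intro integrable_continuous arc_integrand_continuous)
  have "continuous_on (UNIV \<times> cbox 0 pi) (\<lambda>p :: complex \<times> real. weight (eps * cis (snd p)))"
    by (rule continuous_on_compose2[OF weight_arc_continuous[of UNIV]]) (auto intro!: continuous_intros)
  then show "continuous_on (UNIV \<times> cbox 0 pi) (\<lambda>(z, t). - \<i> * (eps * cis t) * arc_integrand z t)"
    unfolding arc_integrand_def by (auto simp: case_prod_unfold intro!: continuous_intros)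
qed auto

text \<open>On the half-circle above the origin \<open>exp (- \<i> * \<xi> * z)\<close> is bounded only as \<open>Re z \<rightarrow> -\<infinity>\<close>.\<close>

lemma arc_bounded: "\<exists>B. \<forall>z. Re z \<le> 0 \<longrightarrow> \<bar>Im z\<bar> \<le> pi \<longrightarrow> norm (arc z) \<le> B"
proof -
  have "compact ((\<lambda>t. weight (eps * cis t)) ` {0..pi})"
    by (intro compact_continuous_image weight_arc_continuous) auto
  then obtain M where M: "\<And>t. t \<in> {0..pi} \<Longrightarrow> norm (weight (eps * cis t)) \<le> M"
    using compact_imp_bounded by (fastforce simp: bounded_iff)
  have "norm (arc z) \<le> exp (eps * pi) * M * eps * (pi - 0)" if z: "Re z \<le> 0" "\<bar>Im z\<bar> \<le> pi" for z
    unfolding arc_def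
  proof (rule integral_bound[OF _ arc_integrand_continuous])
    fix t assume t: "t \<in> {0..pi}"
    \<comment> \<open>The exponent has real part \<open>eps * (sin t * Re z + cos t * Im z)\<close>,
      and \<open>sin t\<close> is nonnegative on the half-circle.\<close>
    have "sin t * Re z \<le> 0"
      using t z sin_ge_zero[of t] by (simp add: mult_nonneg_nonpos)
    moreover have "\<bar>cos t * Im z\<bar> \<le> 1 * pi"
      unfolding abs_mult using z by (intro mult_mono) auto
    then have "cos t * Im z \<le> 1 * pi" by linarith
    ultimately have "eps * (sin t * Re z + cos t * Im z) \<le> eps * pi"
      using eps by (intro mult_left_mono) auto
    then have "norm (exp (- \<i> * (eps * cis t) * z)) \<le> exp (eps * pi)"
      by (simp add: norm_exp_eq_Re algebra_simps)
    then have "norm (exp (- \<i> * (eps * cis t) * z)) * norm (weight (eps * cis t)) * eps \<le> exp (eps * pi) * M * eps"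
      using M[OF t] order_trans[OF norm_ge_zero M[OF t]] eps by (intro mult_mono) auto
    then show "norm (arc_integrand z t) \<le> exp (eps * pi) * M * eps"
      using eps by (simp add: arc_integrand_def norm_mult)
  qed auto
  then show ?thesis by blast
qed

text \<open>The two ray terms are controlled for \<open>Im z < pi\<close> and for
  \<open>- pi < Im z\<close>; the strip is where both hold.\<close>

lemma qdilog_holomorphic: "qdilog h holomorphic_on {z. \<bar>Im z\<bar> < pi}"
proof -
  have 1: "ray holomorphic_on {z. \<bar>Im z\<bar> < pi}"
    by (rule holomorphic_on_subset[OF ray_holomorphic]) auto
  have "(ray \<circ> uminus) holomorphic_on {z. \<bar>Im z\<bar> < pi}"
    by (rule holomorphic_on_compose_gen[OF _ 1]) (auto intro!: holomorphic_intros)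
  then have 2: "(\<lambda>z. ray (- z)) holomorphic_on {z. \<bar>Im z\<bar> < pi}"
    by (simp add: o_def)
  have 3: "arc holomorphic_on {z. \<bar>Im z\<bar> < pi}"
    by (rule holomorphic_on_subset[OF arc_holomorphic]) auto
  show ?thesis
    unfolding qdilog_eq[abs_def] by (intro holomorphic_intros 1 2 3)
qed

lemma qdilog_growth: "\<exists>C. \<forall>z. \<bar>Im z\<bar> < pi \<longrightarrow> norm (qdilog h z) \<le> C * (1 + norm z)"
proof -
  obtain A where A: "\<And>z. Im z \<le> pi \<Longrightarrow> norm (ray z) \<le> A" using ray_bounded by blast
  obtain B where B: "\<And>z. Re z \<le> 0 \<Longrightarrow> \<bar>Im z\<bar> \<le> pi \<Longrightarrow> norm (arc z) \<le> B" using arc_bounded by blast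
  define C where "C = pi * h / 2 * (A + A + B)"
  have left: "norm (qdilog h z) \<le> C" if "Re z \<le> 0" "\<bar>Im z\<bar> < pi" for z
  proof -
    have "norm (ray z + ray (- z) - arc z) \<le> A + A + B"
      using A[of z] A[of "- z"] B[of z] that
      by (intro order_trans[OF norm_triangle_ineq4] add_mono order_trans[OF norm_triangle_ineq]) auto
    then show ?thesis
      using h unfolding qdilog_eq C_def by (simp add: norm_mult)
  qed
  have "norm (qdilog h z) \<le> (1 + \<bar>C\<bar>) * (1 + norm z)" if z: "\<bar>Im z\<bar> < pi" for z
  proof -
    have "norm (qdilog h z) \<le> C + norm z"
    proof (cases "Re z \<le> 0")
      case True
      then show ?thesis using left[of z] z by (simp add: add_increasing2)
    next
      case False
      then have "norm (qdilog h (- z)) \<le> C" using left[of "- z"] z by simp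
      moreover have "qdilog h z = z + qdilog h (- z)" using qdilog_reflect[of z] by (simp add: algebra_simps)
      ultimately show ?thesis using norm_triangle_ineq[of z "qdilog h (- z)"] by simp
    qed
    moreover have "(1 + \<bar>C\<bar>) * (1 + norm z) = 1 + \<bar>C\<bar> + norm z + \<bar>C\<bar> * norm z"
      by (simp add: algebra_simps)
    moreover have "0 \<le> \<bar>C\<bar> * norm z" by simp
    ultimately show ?thesis by linarith
  qed
  then show ?thesis by blast
qed

end

section \<open>Functions that may be substituted into a generator\<close>

lemma (in dilog) tempered_smooth_qdilog:
  assumes "\<bar>y\<bar> < pi" "\<bar>a\<bar> \<le> 1"
  shows "tempered_smooth (\<lambda>x. qdilog h (of_real (a * x) + \<i> * of_real y))"
  using qdilog_growth tempered_smooth_horizontal[OF qdilog_holomorphic _ assms] by blast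

lemma tempered_smooth_affine: "tempered_smooth (\<lambda>x. of_real (a * x) + \<i> * of_real y)" if "\<bar>a\<bar> \<le> 1"
  using that
  by (intro tempered_smooth_horizontal[where f = "\<lambda>w. w" and R = "\<bar>y\<bar> + 1" and C = 1])
    (auto intro!: holomorphic_intros)

lemma tempered_smooth_id: "tempered_smooth (\<lambda>x. of_real x)"
  using tempered_smooth_affine[of 1 0] by simp

lemma tempered_smooth_imaginary: "tempered_smooth (\<lambda>x. \<i> * of_real y)"
  using tempered_smooth_affine[of 0 y] by simp

section \<open>The quantum algebra of the flipped graph\<close>

context quantum_algebra
begin

lemma star_diff: "star (x - y) = star x - star y"
  using star_add[of "x - y" y] by (simp add: eq_diff_eq)

lemma star_minus: "star (- x) = - star x"
  using star_diff[of 0 x] star_diff[of 0 0] by simp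

text \<open>The commutator axiom with scalar 0; temperedness supplies the derivative it asks
  for.\<close>

lemma fc_commute:
  assumes "e \<in> edges G" "tempered_smooth f" "W * Z e = Z e * W"
  shows "W * fc e f = fc e f * W"
proof -
  obtain f' where "\<And>x. (f has_vector_derivative f' x) (at x)"
    using assms(2) unfolding tempered_smooth_def by metis
  then have "W * fc e f - fc e f * W = cscale 0 (fc e f')"
    using assms by (intro fc_commutator) auto
  then show ?thesis by simp
qed

lemma fc_shifted_id: "e \<in> edges G \<Longrightarrow> fc e (\<lambda>x. of_real x + \<i> * of_real y) = Z e + cscale (\<i> * of_real y) 1"
  using fc_add[OF _ tempered_smooth_id tempered_smooth_imaginary] by (simp add: fc_id fc_const)

end

theorem lemma5:
  fixes G G' :: "'h fatgraph" and z :: 'h and g s r p :: nat and hbar \<phi> :: real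
    and cscale :: "complex \<Rightarrow> 'a::ring_1 \<Rightarrow> 'a" and star :: "'a \<Rightarrow> 'a"
    and Z Z' :: "'h set \<Rightarrow> 'a" and fc :: "'h set \<Rightarrow> (real \<Rightarrow> complex) \<Rightarrow> 'a"
    and \<zeta> \<alpha> \<beta> :: "'h set"
  assumes spine: "spine g s r G"
    and algebra: "quantum_algebra cscale star G hbar Z fc"
    and z: "z \<in> darts G" "card (vertex_at G z) = 3"
    and pending: "card (vertex_at G (opp G z)) = 1"
    and order: "p = orb_order G (opp G z)"
    and phi: "\<phi> = pi / p"
    and edges: "\<zeta> = edge_at G z" "\<alpha> = edge_at G (rot G z)" "\<beta> = edge_at G (rot G (rot G z))"
    and distinct: "\<alpha> \<noteq> \<beta>"
    and flipped: "G' = flip z G"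
    and transformed: "Z' = Z(
      \<alpha> := Z \<alpha> + fc \<zeta> (\<lambda>x. qdilog hbar (x + \<i> * \<phi>)) + fc \<zeta> (\<lambda>x. qdilog hbar (x - \<i> * \<phi>)),
      \<beta> := Z \<beta> - fc \<zeta> (\<lambda>x. qdilog hbar (- x + \<i> * \<phi>)) - fc \<zeta> (\<lambda>x. qdilog hbar (- x - \<i> * \<phi>)),
      \<zeta> := - Z \<zeta>)"
  shows "spine g s r G' \<and> quantum_relations cscale star G' hbar Z'"
proof -
  interpret quantum_algebra cscale star G hbar Z fc by (rule algebra)
  interpret pending_flip G z
    using spine z pending by unfold_locales (auto simp: spine_def)
  interpret dilog hbar
    using hbar_pos by unfold_locales
  have in_edges: "\<zeta> \<in> edges G" "\<alpha> \<in> edges G" "\<beta> \<in> edges G"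
    using edges_in by (simp_all add: edges)
  have neq: "\<zeta> \<noteq> \<alpha>" "\<zeta> \<noteq> \<beta>"
    using edge_at_neq by (simp_all add: edges)
  \<comment> \<open>The spine condition at the one-valent end of the pending edge. It places the
    lines with imaginary part \<phi> and -\<phi> inside the strip.\<close>
  have "2 \<le> p"
    using spine darts pending order by (auto simp: spine_def)
  then have "pi / p < pi / 1"
    by (intro divide_strict_left_mono) auto
  then have "\<bar>\<phi>\<bar> < pi"
    using phi by simp

  define f1 where "f1 = (\<lambda>x::real. qdilog hbar (x + \<i> * \<phi>))"
  define f2 where "f2 = (\<lambda>x::real. qdilog hbar (x - \<i> * \<phi>))"
  define h1 where "h1 = (\<lambda>x::real. qdilog hbar (- x + \<i> * \<phi>))"
  define h2 where "h2 = (\<lambda>x::real. qdilog hbar (- x - \<i> * \<phi>))"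
  have tempered: "tempered_smooth f1" "tempered_smooth f2" "tempered_smooth h1" "tempered_smooth h2"
    using tempered_smooth_qdilog[of \<phi> 1] tempered_smooth_qdilog[of "- \<phi>" 1]
      tempered_smooth_qdilog[of \<phi> "- 1"] tempered_smooth_qdilog[of "- \<phi>" "- 1"] \<open>\<bar>\<phi>\<bar> < pi\<close>
    by (simp_all add: f1_def f2_def h1_def h2_def)
  define P where "P = fc \<zeta> f1 + fc \<zeta> f2"
  define Q where "Q = fc \<zeta> h1 + fc \<zeta> h2"
  have Z': "Z' \<alpha> = Z \<alpha> + P" "Z' \<beta> = Z \<beta> - Q" "Z' \<zeta> = - Z \<zeta>"
    "\<And>e. e \<notin> {\<alpha>, \<beta>, \<zeta>} \<Longrightarrow> Z' e = Z e"
    using distinct neq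
    by (simp_all add: transformed P_def Q_def f1_def f2_def h1_def h2_def algebra_simps)

  have star_Z: "star (Z e) = Z e" if "e \<in> edges G" for e
    using relations that by (simp add: quantum_relations_def)
  \<comment> \<open>Conjugation exchanges the shifts by \<open>\<i> * \<phi>\<close> and
    \<open>- \<i> * \<phi>\<close>, so each sum is fixed by the star.\<close>
  have "(\<lambda>x. cnj (f1 x)) = f2" "(\<lambda>x. cnj (f2 x)) = f1" "(\<lambda>x. cnj (h1 x)) = h2" "(\<lambda>x. cnj (h2 x)) = h1"
    by (simp_all add: f1_def f2_def h1_def h2_def cnj_qdilog minus_diff_commute)
  then have "star (fc \<zeta> f1) = fc \<zeta> f2" "star (fc \<zeta> f2) = fc \<zeta> f1"
    "star (fc \<zeta> h1) = fc \<zeta> h2" "star (fc \<zeta> h2) = fc \<zeta> h1"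
    using fc_star[OF in_edges(1)] tempered by metis+
  then have star_PQ: "star P = P" "star Q = Q"
    by (simp_all add: P_def Q_def star_add add.commute)
  have star_Z': "star (Z' e) = Z' e" if "e \<in> edges G" for e
    using that Z' star_Z star_PQ in_edges
    by (cases "e \<in> {\<alpha>, \<beta>, \<zeta>}") (auto simp: star_add star_diff star_minus)

  \<comment> \<open>Reflection pairs \<open>f1\<close> with \<open>h2\<close> and \<open>f2\<close>
    with \<open>h1\<close>; the imaginary constants cancel in the sum.\<close>
  have P: "P = Q + Z \<zeta> + Z \<zeta>"
  proof -
    have f1: "f1 = (\<lambda>x. h2 x + (of_real x + \<i> * of_real \<phi>))"
    proof
      fix x :: real
      have "- (x + \<i> * \<phi>) = - x - \<i> * \<phi>" by simp
      then show "f1 x = h2 x + (of_real x + \<i> * of_real \<phi>)"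
        using qdilog_reflect[of "x + \<i> * \<phi>"] by (simp add: f1_def h2_def algebra_simps)
    qed
    have f2: "f2 = (\<lambda>x. h1 x + (of_real x + \<i> * of_real (- \<phi>)))"
    proof
      fix x :: real
      have "- (x - \<i> * \<phi>) = - x + \<i> * \<phi>" by simp
      then show "f2 x = h1 x + (of_real x + \<i> * of_real (- \<phi>))"
        using qdilog_reflect[of "x - \<i> * \<phi>"] by (simp add: f2_def h1_def algebra_simps)
    qed
    have id: "tempered_smooth (\<lambda>x. of_real x + \<i> * of_real y)" for y
      using tempered_smooth_affine[of 1 y] by simp
    have "fc \<zeta> f1 = fc \<zeta> h2 + (Z \<zeta> + cscale (\<i> * \<phi>) 1)"
      unfolding f1 fc_add[OF in_edges(1) tempered(4) id] fc_shifted_id[OF in_edges(1)] ..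
    moreover have "fc \<zeta> f2 = fc \<zeta> h1 + (Z \<zeta> + cscale (\<i> * of_real (- \<phi>)) 1)"
      unfolding f2 fc_add[OF in_edges(1) tempered(3) id] fc_shifted_id[OF in_edges(1)] ..
    ultimately show ?thesis
      by (simp add: P_def Q_def scale_minus_left algebra_simps)
  qed

  have commute_Q: "W * Q = Q * W" if "W * Z \<zeta> = Z \<zeta> * W" for W
    using fc_commute[OF in_edges(1) tempered(3) that] fc_commute[OF in_edges(1) tempered(4) that]
    by (simp add: Q_def algebra_simps)
  have QZ: "Q * Z \<zeta> = Z \<zeta> * Q"
    using commute_Q[of "Z \<zeta>"] by simp
  have commute_P: "W * P = P * W" if "W * Z \<zeta> = Z \<zeta> * W" for W
    using commute_Q[OF that] that by (simp add: P algebra_simps)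

  \<comment> \<open>The scalar commutator belonging to the bracket value \<open>t\<close>. Its
    additivity reduces commutators to arithmetic with brackets.\<close>
  define K where "K = (\<lambda>t::real. cscale (2 * pi * \<i> * hbar * t) 1)"
  have K: "K 0 = 0" "K (t + u) = K t + K u" "K (- t) = - K t" "K (t - u) = K t - K u" for t u
    by (simp_all add: K_def distrib_left right_diff_distrib scale_left_distrib scale_left_diff_distrib scale_minus_left)
  have comm: "Z d * Z e - Z e * Z d = K (edge_bracket G d e)" if "d \<in> edges G" "e \<in> edges G" for d e
    using relations that by (simp add: quantum_relations_def K_def)

  \<comment> \<open>By antisymmetry it suffices to treat pairs with an edge away from the vertex,
    and the pairs \<zeta>\<alpha>, \<zeta>\<beta>, \<alpha>\<beta>.\<close>
  define rel where "rel d e \<longleftrightarrow> Z' d * Z' e - Z' e * Z' d = K (edge_bracket G' d e)" for d e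
  have rel_sym: "rel e d" if "rel d e" for d e
  proof -
    have "Z' e * Z' d - Z' d * Z' e = - (Z' d * Z' e - Z' e * Z' d)" by simp
    also have "\<dots> = K (edge_bracket G' e d)"
      using that unfolding rel_def edge_bracket_swap[of G' e d] K by simp
    finally show ?thesis unfolding rel_def .
  qed
  have rel_refl: "rel e e" for e
    using edge_bracket_swap[of G' e e] K(1) by (simp add: rel_def)

  have vb: "vertex_bracket G {z, rot G z, rot G (rot G z)} \<zeta> \<alpha> = 1"
    "vertex_bracket G {z, rot G z, rot G (rot G z)} \<zeta> \<beta> = -1"
    "vertex_bracket G {z, rot G z, rot G (rot G z)} \<alpha> \<beta> = 1"
    "\<And>d e. d \<notin> {\<alpha>, \<beta>, \<zeta>} \<Longrightarrow> vertex_bracket G {z, rot G z, rot G (rot G z)} d e = 0"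
    using vertex_bracket_z distinct unfolding edges by blast+
  have pend: "edge_bracket G \<zeta> \<alpha> = 1" "edge_bracket G \<zeta> \<beta> = -1"
    "\<And>d. d \<notin> {\<alpha>, \<beta>, \<zeta>} \<Longrightarrow> edge_bracket G d \<zeta> = 0"
    using edge_bracket_pending vb vertex_bracket_swap[of G "{z, rot G z, rot G (rot G z)}" \<zeta>]
      edge_bracket_swap[of G _ \<zeta>] by (simp_all add: edges(1)[symmetric])
  \<comment> \<open>The edges \<alpha> and \<beta> may also meet at another vertex, so only the
    change of their bracket is determined.\<close>
  have bracket: "edge_bracket G' \<zeta> \<alpha> = -1" "edge_bracket G' \<zeta> \<beta> = 1"
    "edge_bracket G' \<alpha> \<beta> = edge_bracket G \<alpha> \<beta> - 2"
    "\<And>d e. d \<notin> {\<alpha>, \<beta>, \<zeta>} \<Longrightarrow> edge_bracket G' d e = edge_bracket G d e"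
    using vb pend by (simp_all add: flipped edge_bracket_flip)

  have ZA: "Z \<zeta> * Z \<alpha> - Z \<alpha> * Z \<zeta> = K 1" and ZB: "Z \<zeta> * Z \<beta> - Z \<beta> * Z \<zeta> = - K 1"
    using comm[of \<zeta> \<alpha>] comm[of \<zeta> \<beta>] in_edges pend K(3)[of 1] by simp_all
  \<comment> \<open>The brackets of \<zeta> with \<alpha> and with \<beta> are opposite.\<close>
  have "(Z \<alpha> + Z \<beta>) * Z \<zeta> = Z \<zeta> * (Z \<alpha> + Z \<beta>)"
    using ZA ZB by (simp add: algebra_simps)
  then have ABQ: "(Z \<alpha> + Z \<beta>) * Q = Q * (Z \<alpha> + Z \<beta>)"
    by (rule commute_Q)
  have PQ: "Q * P = P * Q" and ZP: "Z \<zeta> * P = P * Z \<zeta>"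
    using commute_P QZ by auto

  have rel_other: "rel d e" if d: "d \<in> edges G" "d \<notin> {\<alpha>, \<beta>, \<zeta>}" and e: "e \<in> edges G" for d e
  proof -
    have "Z d * Z \<zeta> = Z \<zeta> * Z d"
      using comm[OF d(1) in_edges(1)] pend(3)[OF d(2)] K(1) by simp
    then have d_PQ: "Z d * P = P * Z d" "Z d * Q = Q * Z d"
      using commute_P commute_Q by auto
    have Z'd: "Z' d = Z d" using Z'(4) d(2) .
    have "Z' d * Z' e - Z' e * Z' d = K (edge_bracket G d e)"
    proof -
      consider "e = \<alpha>" | "e = \<beta>" | "e = \<zeta>" | "e \<notin> {\<alpha>, \<beta>, \<zeta>}" by blast
      then show ?thesis
      proof cases
        case 1
        have "Z' d * Z' e - Z' e * Z' d = Z d * Z e - Z e * Z d + (Z d * P - P * Z d)"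
          unfolding 1 Z'd Z' by (simp add: distrib_left distrib_right)
        then show ?thesis unfolding d_PQ comm[OF d(1) e] by simp
      next
        case 2
        have "Z' d * Z' e - Z' e * Z' d = Z d * Z e - Z e * Z d - (Z d * Q - Q * Z d)"
          unfolding 2 Z'd Z' by (simp add: left_diff_distrib right_diff_distrib)
        then show ?thesis unfolding d_PQ comm[OF d(1) e] by simp
      next
        case 3
        have "Z' d * Z' e - Z' e * Z' d = - (Z d * Z e - Z e * Z d)"
          unfolding 3 Z'd Z' by simp
        then show ?thesis
          unfolding comm[OF d(1) e] unfolding 3 pend(3)[OF d(2)] K by simp
      next
        case 4
        show ?thesis unfolding Z'd Z'(4)[OF 4] by (rule comm[OF d(1) e])
      qed
    qed
    then show ?thesis
      unfolding rel_def bracket(4)[OF d(2)] .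
  qed
  have rel_ZA: "rel \<zeta> \<alpha>"
    using ZA ZP K(3)[of 1] unfolding rel_def bracket Z' by (simp add: algebra_simps)
  have rel_ZB: "rel \<zeta> \<beta>"
    using ZB QZ unfolding rel_def bracket Z' by (simp add: algebra_simps)
  have rel_AB: "rel \<alpha> \<beta>"
  proof -
    \<comment> \<open>Here \<open>P\<close> is expanded as \<open>Q + Z \<zeta> + Z \<zeta>\<close>;
      each of the two copies of \<open>Z \<zeta>\<close> lowers the bracket by 1.\<close>
    have "(Z \<alpha> + P) * (Z \<beta> - Q) - (Z \<beta> - Q) * (Z \<alpha> + P)
        = (Z \<alpha> * Z \<beta> - Z \<beta> * Z \<alpha>) - ((Z \<alpha> + Z \<beta>) * Q - Q * (Z \<alpha> + Z \<beta>))
          + (Z \<zeta> * Z \<beta> - Z \<beta> * Z \<zeta>) + (Z \<zeta> * Z \<beta> - Z \<beta> * Z \<zeta>) - (P * Q - Q * P)"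
      by (simp add: P algebra_simps)
    also have "\<dots> = K (edge_bracket G \<alpha> \<beta>) - K 1 - K 1"
      using ABQ PQ ZB comm in_edges by simp
    also have "\<dots> = K (edge_bracket G \<alpha> \<beta> - 1 - 1)"
      unfolding K ..
    finally show ?thesis
      unfolding rel_def bracket Z' by simp
  qed
  have "rel d e" if "d \<in> edges G" "e \<in> edges G" for d e
    using that rel_other rel_sym rel_refl rel_ZA rel_ZB rel_AB
    by (cases "d \<in> {\<alpha>, \<beta>, \<zeta>}"; cases "e \<in> {\<alpha>, \<beta>, \<zeta>}") auto
  then have "quantum_relations cscale star G' hbar Z'"
    using star_Z' by (simp add: quantum_relations_def rel_def K_def flipped)
  then show ?thesis
    using spine_flip[OF spine] by (simp add: flipped)
qed

end
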